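(* Let $(Q,\lambda,J)$ be a contact triad with contact distribution $\xi=\ker\lambda$, Reeb vector field $X_\lambda$, projection $\pi:TQ\to\xi$ and triad metric $g$. Let $\nabla$ be an affine connection on $Q$, with torsion $T$, satisfying: \begin{enumerate} \item $\nabla g=0$; \item $T(X_\lambda,Y)=0$ for all $Y\in TQ$; \item $\nabla_{X_\lambda}X_\lambda=0$, and $\nabla_YX_\lambda\in\xi$ for $Y\in\xi$; \item $\nabla^\pi:=\pi\nabla|_\xi$ is a Hermitian connection of the bundle $\xi\to Q$ with Hermitian structure $(d\lambda,J)$; \item $\pi T(JY,Y)=0$ for all $Y\in\xi$. \end{enumerate} Then the condition $$\nabla_{JY}X_\lambda+J\nabla_YX_\lambda=0\quad\text{for all }Y\in\xi$$ is equivalent to the statement that $\lambda$ is $CR$-holomorphic (with respect to $\nabla$).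
   Context: $Q$ is a smooth manifold of dimension $2n+1$ with contact form $\lambda$ (i.e. $\lambda\wedge(d\lambda)^n$ is nowhere zero) and $\xi=\ker\lambda$. The Reeb vector field $X_\lambda$ is the unique vector field with $\lambda(X_\lambda)=1$ and $d\lambda(X_\lambda,\cdot)=0$; then $TQ=\mathbb{R}\{X_\lambda\}\oplus\xi$ and $\pi:TQ\to\xi$ is the corresponding projection. A contact triad $(Q,\lambda,J)$ consists of such data with an endomorphism $J:\xi\to\xi$, $J^2=-\mathrm{id}_\xi$, compatible with $d\lambda$: $d\lambda(JY,JZ)=d\lambda(Y,Z)$ for $Y,Z\in\xi$ and $d\lambda(Y,JY)>0$ for $0\ne Y\in\xi$. $J$ is extended to $TQ$ by $JX_\lambda=0$. The triad metric is $g(h,k)=\lambda(h)\lambda(k)+d\lambda(\pi h,J\pi k)$. The torsion is $T(X,Y)=\nabla_XY-\nabla_YX-[X,Y]$. $\nabla^\pi_XY=\pi\nabla_XY$ (for $X\in TQ$, $Y$ a section of $\xi$) is Hermitian if it commutes with $J$ and preserves $g|_\xi$. For a $k$-form $\alpha$ (or covariant $k$-tensor), $J\alpha(Y_1,\dots,Y_k):=\alpha(JY_1,\dots,JY_k)$. A $k$-form $\alpha$ is called $CR$-holomorphic (with respect to $\nabla$) if $\nabla_{X_\lambda}\alpha=0$ and $\nabla_Y\alpha+J\nabla_{JY}\alpha=0$ for all $Y\in\xi$. *)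

theory Defs
  imports
    "HOL-Analysis.Analysis"
    "HOL-Combinatorics.Permutations"
    "HOL-Library.Function_Algebras"
begin

section \<open>Smooth manifolds\<close>

primrec times_differentiable_on ::
  "nat \<Rightarrow> 'e::euclidean_space set \<Rightarrow> ('e \<Rightarrow> 'f::real_normed_vector) \<Rightarrow> bool"
where
  "times_differentiable_on 0 S f \<longleftrightarrow> continuous_on S f"
| "times_differentiable_on (Suc k) S f \<longleftrightarrow>
     (\<forall>x\<in>S. f differentiable (at x)) \<and>
     (\<forall>v. times_differentiable_on k S (\<lambda>x. frechet_derivative f (at x) v))"

text \<open>Only used for open \<open>S\<close>.\<close>

definition smooth_on :: "'e::euclidean_space set \<Rightarrow> ('e \<Rightarrow> 'f::real_normed_vector) \<Rightarrow> bool" where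
  "smooth_on S f \<longleftrightarrow> (\<forall>k. times_differentiable_on k S f)"

text \<open>
  The underlying space of the manifold is the whole type \<open>'q\<close>. Hausdorffness and second
  countability are class constraints; the dimension of the manifold is \<open>DIM('e)\<close>.
  A chart is a pair of its domain and its coordinate map; the values of the coordinate map
  outside its domain are irrelevant.
\<close>

type_synonym ('q, 'e) atlas = "('q set \<times> ('q \<Rightarrow> 'e)) set"

definition smooth_atlas ::
  "('q::{t2_space,second_countable_topology}, 'e::euclidean_space) atlas \<Rightarrow> bool"
where
  "smooth_atlas A \<longleftrightarrow>
     (\<Union>(U, \<phi>)\<in>A. U) = UNIV \<and>
     (\<forall>(U, \<phi>)\<in>A. open U \<and> open (\<phi> ` U) \<and> homeomorphism U (\<phi> ` U) \<phi> (inv_into U \<phi>)) \<and>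
     (\<forall>(U, \<phi>)\<in>A. \<forall>(V, \<psi>)\<in>A. smooth_on (\<phi> ` (U \<inter> V)) (\<psi> \<circ> inv_into U \<phi>))"

definition smooth_fun ::
  "('q::{t2_space,second_countable_topology}, 'e::euclidean_space) atlas \<Rightarrow> ('q \<Rightarrow> real) \<Rightarrow> bool"
where
  "smooth_fun A f \<longleftrightarrow> (\<forall>(U, \<phi>)\<in>A. smooth_on (\<phi> ` U) (f \<circ> inv_into U \<phi>))"


section \<open>Vector fields\<close>

text \<open>
  A tangent vector at \<open>p\<close> is a derivation at \<open>p\<close> of the algebra of smooth functions. It is
  fixed to be \<open>0\<close> on non-smooth functions, so that equality of tangent vectors is
  equality in HOL. Sums, differences, negatives and zero of tangent vectors and of vector fields
  are the pointwise ones on function types.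
\<close>

type_synonym 'q tangent = "('q \<Rightarrow> real) \<Rightarrow> real"
type_synonym 'q vfield = "'q \<Rightarrow> 'q tangent"

definition tangent_space ::
  "('q::{t2_space,second_countable_topology}, 'e::euclidean_space) atlas \<Rightarrow> 'q \<Rightarrow> 'q tangent set"
where
  "tangent_space A p =
     {v. (\<forall>f g. smooth_fun A f \<longrightarrow> smooth_fun A g \<longrightarrow> v (\<lambda>x. f x + g x) = v f + v g) \<and>
         (\<forall>c f. smooth_fun A f \<longrightarrow> v (\<lambda>x. c * f x) = c * v f) \<and>
         (\<forall>f g. smooth_fun A f \<longrightarrow> smooth_fun A g \<longrightarrow>
            v (\<lambda>x. f x * g x) = f p * v g + g p * v f) \<and>
         (\<forall>f. \<not> smooth_fun A f \<longrightarrow> v f = 0)}"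

definition app :: "'q vfield \<Rightarrow> ('q \<Rightarrow> real) \<Rightarrow> 'q \<Rightarrow> real" where
  "app X f = (\<lambda>p. X p f)"

definition vfields ::
  "('q::{t2_space,second_countable_topology}, 'e::euclidean_space) atlas \<Rightarrow> 'q vfield set"
where
  "vfields A =
     {X. (\<forall>p. X p \<in> tangent_space A p) \<and> (\<forall>f. smooth_fun A f \<longrightarrow> smooth_fun A (app X f))}"

definition fun_scale :: "('q \<Rightarrow> real) \<Rightarrow> 'q vfield \<Rightarrow> 'q vfield" (infixr "\<odot>" 75) where
  "f \<odot> X = (\<lambda>p h. f p * X p h)"

definition lie_bracket ::
  "('q::{t2_space,second_countable_topology}, 'e::euclidean_space) atlas
     \<Rightarrow> 'q vfield \<Rightarrow> 'q vfield \<Rightarrow> 'q vfield"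
where
  "lie_bracket A X Y =
     (\<lambda>p f. if smooth_fun A f then X p (app Y f) - Y p (app X f) else 0)"


section \<open>Covariant tensors and differential forms\<close>

text \<open>
  A covariant tensor of degree \<open>k\<close> is a function on lists of \<open>k\<close> vector fields that is
  multilinear over the smooth functions. Its values on other lists are irrelevant.
\<close>

type_synonym 'q cotensor = "'q vfield list \<Rightarrow> 'q \<Rightarrow> real"

definition vfield_lists ::
  "('q::{t2_space,second_countable_topology}, 'e::euclidean_space) atlas \<Rightarrow> nat \<Rightarrow> 'q vfield list set"
where
  "vfield_lists A k = {Zs. length Zs = k \<and> set Zs \<subseteq> vfields A}"

definition covariant_tensor ::
  "('q::{t2_space,second_countable_topology}, 'e::euclidean_space) atlas \<Rightarrow> nat \<Rightarrow> 'q cotensor \<Rightarrow> bool"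
where
  "covariant_tensor A k \<alpha> \<longleftrightarrow>
     (\<forall>Zs\<in>vfield_lists A k. smooth_fun A (\<alpha> Zs) \<and>
        (\<forall>i<k. \<forall>V\<in>vfields A. \<forall>W\<in>vfields A. \<forall>f. smooth_fun A f \<longrightarrow>
           \<alpha> (Zs[i := f \<odot> V + W]) = (\<lambda>p. f p * \<alpha> (Zs[i := V]) p + \<alpha> (Zs[i := W]) p)))"

definition differential_form ::
  "('q::{t2_space,second_countable_topology}, 'e::euclidean_space) atlas \<Rightarrow> nat \<Rightarrow> 'q cotensor \<Rightarrow> bool"
where
  "differential_form A k \<alpha> \<longleftrightarrow> covariant_tensor A k \<alpha> \<and>
     (\<forall>Zs\<in>vfield_lists A k. \<forall>i<k. \<forall>j<k. i \<noteq> j \<and> Zs ! i = Zs ! j \<longrightarrow> \<alpha> Zs = 0)"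

definition wedge :: "nat \<Rightarrow> nat \<Rightarrow> 'q cotensor \<Rightarrow> 'q cotensor \<Rightarrow> 'q cotensor" where
  "wedge k l \<alpha> \<beta> Zs = (\<lambda>p.
     (\<Sum>\<sigma> | \<sigma> permutes {..<k + l}.
        of_int (sign \<sigma>) * \<alpha> (take k (permute_list \<sigma> Zs)) p * \<beta> (drop k (permute_list \<sigma> Zs)) p)
     / (fact k * fact l))"

primrec wedge_power :: "nat \<Rightarrow> 'q cotensor \<Rightarrow> nat \<Rightarrow> 'q cotensor" where
  "wedge_power k \<alpha> 0 = (\<lambda>Zs p. 1)"
| "wedge_power k \<alpha> (Suc m) = wedge k (m * k) \<alpha> (wedge_power k \<alpha> m)"

text \<open>The exterior derivative, for 1-forms only.\<close>

definition ext_deriv ::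
  "('q::{t2_space,second_countable_topology}, 'e::euclidean_space) atlas \<Rightarrow> 'q cotensor \<Rightarrow> 'q cotensor"
where
  "ext_deriv A \<alpha> Zs = (let X = Zs ! 0; Y = Zs ! 1 in
     app X (\<alpha> [Y]) - app Y (\<alpha> [X]) - \<alpha> [lie_bracket A X Y])"

definition nowhere_zero ::
  "('q::{t2_space,second_countable_topology}, 'e::euclidean_space) atlas \<Rightarrow> nat \<Rightarrow> 'q cotensor \<Rightarrow> bool"
where
  "nowhere_zero A k \<alpha> \<longleftrightarrow> (\<forall>p. \<exists>Zs\<in>vfield_lists A k. \<alpha> Zs p \<noteq> 0)"


section \<open>Contact triads\<close>

definition contact_form ::
  "('q::{t2_space,second_countable_topology}, 'e::euclidean_space) atlas \<Rightarrow> nat \<Rightarrow> 'q cotensor \<Rightarrow> bool"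
where
  "contact_form A n lam \<longleftrightarrow> differential_form A 1 lam \<and>
     nowhere_zero A (2 * n + 1) (wedge 1 (2 * n) lam (wedge_power 2 (ext_deriv A lam) n))"

text \<open>Sections of the contact distribution \<open>\<xi> = ker lam\<close>.\<close>

definition contact_sections ::
  "('q::{t2_space,second_countable_topology}, 'e::euclidean_space) atlas \<Rightarrow> 'q cotensor \<Rightarrow> 'q vfield set"
where
  "contact_sections A lam = {Y \<in> vfields A. lam [Y] = 0}"

definition reeb_field ::
  "('q::{t2_space,second_countable_topology}, 'e::euclidean_space) atlas
     \<Rightarrow> 'q cotensor \<Rightarrow> 'q vfield \<Rightarrow> bool"
where
  "reeb_field A lam R \<longleftrightarrow> R \<in> vfields A \<and> lam [R] = (\<lambda>p. 1) \<and>
     (\<forall>Y\<in>vfields A. ext_deriv A lam [R, Y] = 0)"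

definition contact_proj :: "'q cotensor \<Rightarrow> 'q vfield \<Rightarrow> 'q vfield \<Rightarrow> 'q vfield" where
  "contact_proj lam R Z = Z - lam [Z] \<odot> R"

text \<open>
  The endomorphism \<open>J\<close> of the bundle \<open>\<xi>\<close> is given by its action on sections of \<open>\<xi>\<close>;
  linearity over the smooth functions makes it pointwise.
\<close>

definition contact_triad ::
  "('q::{t2_space,second_countable_topology}, 'e::euclidean_space) atlas
     \<Rightarrow> nat \<Rightarrow> 'q cotensor \<Rightarrow> ('q vfield \<Rightarrow> 'q vfield) \<Rightarrow> bool"
where
  "contact_triad A n lam J \<longleftrightarrow>
     smooth_atlas A \<and> DIM('e) = 2 * n + 1 \<and> contact_form A n lam \<and>
     (\<forall>Y\<in>contact_sections A lam. J Y \<in> contact_sections A lam) \<and>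
     (\<forall>Y\<in>contact_sections A lam. \<forall>Z\<in>contact_sections A lam. \<forall>f. smooth_fun A f \<longrightarrow>
        J (f \<odot> Y + Z) = f \<odot> J Y + J Z) \<and>
     (\<forall>Y\<in>contact_sections A lam. J (J Y) = - Y) \<and>
     (\<forall>Y\<in>contact_sections A lam. \<forall>Z\<in>contact_sections A lam.
        ext_deriv A lam [J Y, J Z] = ext_deriv A lam [Y, Z]) \<and>
     (\<forall>Y\<in>contact_sections A lam. \<forall>p. Y p \<noteq> 0 \<longrightarrow> ext_deriv A lam [Y, J Y] p > 0)"

text \<open>The extension of \<open>J\<close> to the whole tangent bundle by \<open>0\<close> on the Reeb field.\<close>

definition J_ext ::
  "'q cotensor \<Rightarrow> 'q vfield \<Rightarrow> ('q vfield \<Rightarrow> 'q vfield) \<Rightarrow> 'q vfield \<Rightarrow> 'q vfield"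
where
  "J_ext lam R J Z = J (contact_proj lam R Z)"

definition triad_metric ::
  "('q::{t2_space,second_countable_topology}, 'e::euclidean_space) atlas
     \<Rightarrow> 'q cotensor \<Rightarrow> 'q vfield \<Rightarrow> ('q vfield \<Rightarrow> 'q vfield) \<Rightarrow> 'q cotensor"
where
  "triad_metric A lam R J Zs = (let h = Zs ! 0; k = Zs ! 1 in
     lam [h] * lam [k]
       + ext_deriv A lam [contact_proj lam R h, J (contact_proj lam R k)])"


section \<open>Connections\<close>

type_synonym 'q connection = "'q vfield \<Rightarrow> 'q vfield \<Rightarrow> 'q vfield"

definition affine_connection ::
  "('q::{t2_space,second_countable_topology}, 'e::euclidean_space) atlas \<Rightarrow> 'q connection \<Rightarrow> bool"
where
  "affine_connection A D \<longleftrightarrow>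
     (\<forall>X\<in>vfields A. \<forall>Y\<in>vfields A. D X Y \<in> vfields A) \<and>
     (\<forall>X\<in>vfields A. \<forall>X'\<in>vfields A. \<forall>Y\<in>vfields A. \<forall>f. smooth_fun A f \<longrightarrow>
        D (f \<odot> X + X') Y = f \<odot> D X Y + D X' Y) \<and>
     (\<forall>X\<in>vfields A. \<forall>Y\<in>vfields A. \<forall>Y'\<in>vfields A. D X (Y + Y') = D X Y + D X Y') \<and>
     (\<forall>X\<in>vfields A. \<forall>Y\<in>vfields A. \<forall>f. smooth_fun A f \<longrightarrow>
        D X (f \<odot> Y) = app X f \<odot> Y + f \<odot> D X Y)"

definition torsion ::
  "('q::{t2_space,second_countable_topology}, 'e::euclidean_space) atlas
     \<Rightarrow> 'q connection \<Rightarrow> 'q vfield \<Rightarrow> 'q vfield \<Rightarrow> 'q vfield"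
where
  "torsion A D X Y = D X Y - D Y X - lie_bracket A X Y"

text \<open>The covariant derivative of a covariant tensor of any degree.\<close>

definition cov_deriv :: "'q connection \<Rightarrow> 'q vfield \<Rightarrow> 'q cotensor \<Rightarrow> 'q cotensor" where
  "cov_deriv D X \<alpha> Zs = (\<lambda>p.
     app X (\<alpha> Zs) p - (\<Sum>i<length Zs. \<alpha> (Zs[i := D X (Zs ! i)]) p))"

definition parallel ::
  "('q::{t2_space,second_countable_topology}, 'e::euclidean_space) atlas
     \<Rightarrow> 'q connection \<Rightarrow> nat \<Rightarrow> 'q cotensor \<Rightarrow> bool"
where
  "parallel A D k \<alpha> \<longleftrightarrow>
     (\<forall>X\<in>vfields A. \<forall>Zs\<in>vfield_lists A k. cov_deriv D X \<alpha> Zs = 0)"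

definition connection_pi ::
  "'q cotensor \<Rightarrow> 'q vfield \<Rightarrow> 'q connection \<Rightarrow> 'q connection"
where
  "connection_pi lam R D X Y = contact_proj lam R (D X Y)"

text \<open>The connection \<open>N\<close> of \<open>\<xi>\<close> commutes with \<open>J\<close> and preserves the metric \<open>g\<close> on \<open>\<xi>\<close>.\<close>

definition hermitian_connection ::
  "('q::{t2_space,second_countable_topology}, 'e::euclidean_space) atlas
     \<Rightarrow> 'q cotensor \<Rightarrow> ('q vfield \<Rightarrow> 'q vfield) \<Rightarrow> 'q cotensor \<Rightarrow> 'q connection \<Rightarrow> bool"
where
  "hermitian_connection A lam J g N \<longleftrightarrow>
     (\<forall>X\<in>vfields A. \<forall>Y\<in>contact_sections A lam. N X (J Y) = J (N X Y)) \<and>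
     (\<forall>X\<in>vfields A. \<forall>Y\<in>contact_sections A lam. \<forall>Z\<in>contact_sections A lam.
        app X (g [Y, Z]) = g [N X Y, Z] + g [Y, N X Z])"

definition CR_holomorphic ::
  "('q::{t2_space,second_countable_topology}, 'e::euclidean_space) atlas
     \<Rightarrow> 'q cotensor \<Rightarrow> 'q vfield \<Rightarrow> ('q vfield \<Rightarrow> 'q vfield) \<Rightarrow> 'q connection
     \<Rightarrow> nat \<Rightarrow> 'q cotensor \<Rightarrow> bool"
where
  "CR_holomorphic A lam R J D k \<alpha> \<longleftrightarrow>
     (\<forall>Zs\<in>vfield_lists A k. cov_deriv D R \<alpha> Zs = 0) \<and>
     (\<forall>Y\<in>contact_sections A lam. \<forall>Zs\<in>vfield_lists A k.
        cov_deriv D Y \<alpha> Zs + cov_deriv D (J Y) \<alpha> (map (J_ext lam R J) Zs) = 0)"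

end

theory Submission
  imports Defs
begin

text \<open>
  The point is that the triad metric turns the Reeb field into the contact form: \<open>lam = g(R, _)\<close>,
  because the projection of \<open>R\<close> to \<open>\<xi>\<close> vanishes and \<open>lam(R) = 1\<close>. A metric connection commutes
  with this duality, so \<open>(D\<^sub>X lam)(Z) = g(D\<^sub>X R, Z)\<close> for all \<open>X\<close> and \<open>Z\<close> (\<open>cov_deriv_contact_form\<close>).
  Hence \<open>D R R = 0\<close> already gives the first half of CR-holomorphicity.

  For the second half let \<open>Y\<close> be a section of \<open>\<xi>\<close> and put \<open>W = D\<^sub>J\<^sub>Y R + J (D\<^sub>Y R)\<close>, again a section
  of \<open>\<xi>\<close>. Writing \<open>g\<close> on \<open>\<xi>\<close> as \<open>dlam(_, J _)\<close> and using the \<open>J\<close>-invariance of \<open>dlam\<close>,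
  \<open>(D\<^sub>Y lam)(Z) + (D\<^sub>J\<^sub>Y lam)(J Z) = dlam(D\<^sub>Y R, J \<pi> Z) - dlam(D\<^sub>J\<^sub>Y R, \<pi> Z) = - dlam(W, \<pi> Z)\<close>.
  If \<open>W = 0\<close> this vanishes. If it vanishes for all \<open>Z\<close>, then \<open>Z = J W\<close> gives \<open>dlam(W, J W) = 0\<close>,
  and \<open>W = 0\<close> because \<open>dlam(_, J _)\<close> is positive definite on \<open>\<xi>\<close>.

  The computation takes place among global vector fields. It rests on the facts that smooth functions
  form an algebra, that vector fields are a module over them closed under the Lie bracket, and
  that \<open>dlam\<close> is biadditive; the last of these uses the bracket, since \<open>lam\<close> is
  additive only on genuine vector fields.
\<close>

section \<open>The algebra of smooth functions\<close>

lemma differentiable_cong_open: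
  assumes "open S" "x \<in> S" "\<And>y. y \<in> S \<Longrightarrow> f y = g y"
  shows "f differentiable (at x) \<longleftrightarrow> g differentiable (at x)"
    and "frechet_derivative f (at x) = frechet_derivative g (at x)"
proof -
  have "(f has_derivative f') (at x) \<longleftrightarrow> (g has_derivative f') (at x)" for f'
    using assms by (metis has_derivative_transform_within_open)
  then show "f differentiable (at x) \<longleftrightarrow> g differentiable (at x)"
    and "frechet_derivative f (at x) = frechet_derivative g (at x)"
    by (auto simp: differentiable_def frechet_derivative_def)
qed

text \<open>
  The sum and product rules identify \<open>\<lambda>x. frechet_derivative f (at x) v\<close> at points of \<open>S\<close> only,
  while iterated differentiability takes it as a function on the whole space; openness
  of \<open>S\<close> makes its values off \<open>S\<close> irrelevant.
\<close>

lemma times_differentiable_on_cong: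
  assumes "open S" "\<And>y. y \<in> S \<Longrightarrow> f y = g y"
  shows "times_differentiable_on k S f \<longleftrightarrow> times_differentiable_on k S g"
  using assms(2)
proof (induction k arbitrary: f g)
  case 0
  then show ?case by (simp cong: continuous_on_cong)
next
  case (Suc k)
  have "times_differentiable_on k S (\<lambda>x. frechet_derivative f (at x) v) \<longleftrightarrow>
        times_differentiable_on k S (\<lambda>x. frechet_derivative g (at x) v)" for v
    by (rule Suc.IH) (simp add: differentiable_cong_open(2)[OF assms(1) _ Suc.prems])
  then show ?case
    using differentiable_cong_open(1)[OF assms(1) _ Suc.prems] by simp
qed

lemma times_differentiable_on_SucD:
  "times_differentiable_on (Suc k) S f \<Longrightarrow> times_differentiable_on k S f"
proof (induction k arbitrary: f)
  case 0
  then show ?case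
    by (auto intro!: continuous_at_imp_continuous_on differentiable_imp_continuous_within)
next
  case (Suc k)
  from Suc.prems have "\<forall>x\<in>S. f differentiable (at x)"
    and "\<And>v. times_differentiable_on (Suc k) S (\<lambda>x. frechet_derivative f (at x) v)"
    by simp_all
  with Suc.IH show ?case by simp
qed

lemma times_differentiable_on_const: "times_differentiable_on k S (\<lambda>x. c)"
  by (induction k arbitrary: c) simp_all

lemma times_differentiable_on_add:
  assumes "open S"
  shows "times_differentiable_on k S f \<Longrightarrow> times_differentiable_on k S g \<Longrightarrow>
    times_differentiable_on k S (\<lambda>x. f x + g x)"
proof (induction k arbitrary: f g)
  case 0
  then show ?case by (simp add: continuous_on_add)
next
  case (Suc k)
  have "frechet_derivative (\<lambda>x. f x + g x) (at x) =
      (\<lambda>v. frechet_derivative f (at x) v + frechet_derivative g (at x) v)" if "x \<in> S" for x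
    using Suc.prems that
    by (intro frechet_derivative_at[symmetric] has_derivative_add)
       (simp_all add: frechet_derivative_works)
  then have "times_differentiable_on k S (\<lambda>x. frechet_derivative (\<lambda>x. f x + g x) (at x) v) \<longleftrightarrow>
      times_differentiable_on k S (\<lambda>x. frechet_derivative f (at x) v + frechet_derivative g (at x) v)"
    for v
    by (intro times_differentiable_on_cong[OF assms]) simp
  then show ?case using Suc by (simp add: differentiable_add)
qed

lemma times_differentiable_on_mult:
  fixes f g :: "'e::euclidean_space \<Rightarrow> 'f::real_normed_algebra"
  assumes "open S"
  shows "times_differentiable_on k S f \<Longrightarrow> times_differentiable_on k S g \<Longrightarrow>
    times_differentiable_on k S (\<lambda>x. f x * g x)"
proof (induction k arbitrary: f g)
  case 0
  then show ?case by (simp add: continuous_on_mult)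
next
  case (Suc k)
  have "frechet_derivative (\<lambda>x. f x * g x) (at x) =
      (\<lambda>v. f x * frechet_derivative g (at x) v + frechet_derivative f (at x) v * g x)" if "x \<in> S" for x
    using Suc.prems that
    by (intro frechet_derivative_at[symmetric] has_derivative_mult)
       (simp_all add: frechet_derivative_works)
  then have "times_differentiable_on k S (\<lambda>x. frechet_derivative (\<lambda>x. f x * g x) (at x) v) \<longleftrightarrow>
      times_differentiable_on k S
        (\<lambda>x. f x * frechet_derivative g (at x) v + frechet_derivative f (at x) v * g x)" for v
    by (intro times_differentiable_on_cong[OF assms]) simp
  \<comment> \<open>The product rule keeps one factor undifferentiated, so one order of differentiability is given away.\<close>
  moreover have "times_differentiable_on k S f" "times_differentiable_on k S g"
    using Suc.prems by (auto dest: times_differentiable_on_SucD simp del: times_differentiable_on.simps)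
  ultimately show ?case
    using Suc by (simp add: times_differentiable_on_add[OF assms])
qed

lemma open_chart_image: "smooth_atlas A \<Longrightarrow> (U, \<phi>) \<in> A \<Longrightarrow> open (\<phi> ` U)"
  unfolding smooth_atlas_def by blast

lemma smooth_fun_const: "smooth_fun A (\<lambda>x. c)"
  by (auto simp: smooth_fun_def smooth_on_def comp_def times_differentiable_on_const)

lemma smooth_fun_add:
  "smooth_atlas A \<Longrightarrow> smooth_fun A f \<Longrightarrow> smooth_fun A g \<Longrightarrow> smooth_fun A (\<lambda>x. f x + g x)"
  by (fastforce simp: smooth_fun_def smooth_on_def comp_def
      intro: times_differentiable_on_add open_chart_image)

lemma smooth_fun_mult:
  "smooth_atlas A \<Longrightarrow> smooth_fun A f \<Longrightarrow> smooth_fun A g \<Longrightarrow> smooth_fun A (\<lambda>x. f x * g x)"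
  by (fastforce simp: smooth_fun_def smooth_on_def comp_def
      intro: times_differentiable_on_mult open_chart_image)

lemma smooth_fun_diff:
  assumes "smooth_atlas A" "smooth_fun A f" "smooth_fun A g"
  shows "smooth_fun A (\<lambda>x. f x - g x)"
  using smooth_fun_add[OF assms(1,2) smooth_fun_mult[OF assms(1) smooth_fun_const[of A "-1"] assms(3)]]
  by simp


section \<open>The module of vector fields and the Lie bracket\<close>

lemma tangent_laws:
  assumes "v \<in> tangent_space A p"
  shows tangent_add: "smooth_fun A f \<Longrightarrow> smooth_fun A g \<Longrightarrow> v (\<lambda>x. f x + g x) = v f + v g"
    and tangent_scale: "smooth_fun A f \<Longrightarrow> v (\<lambda>x. c * f x) = c * v f"
    and tangent_mult: "smooth_fun A f \<Longrightarrow> smooth_fun A g \<Longrightarrow>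
      v (\<lambda>x. f x * g x) = f p * v g + g p * v f"
    and tangent_not_smooth: "\<not> smooth_fun A f \<Longrightarrow> v f = 0"
  using assms by (simp_all add: tangent_space_def)

lemma vfield_tangent: "X \<in> vfields A \<Longrightarrow> X p \<in> tangent_space A p"
  and vfield_smooth: "X \<in> vfields A \<Longrightarrow> smooth_fun A f \<Longrightarrow> smooth_fun A (\<lambda>p. X p f)"
  by (simp_all add: vfields_def app_def)

lemma vfieldsI:
  assumes "\<And>p f g. smooth_fun A f \<Longrightarrow> smooth_fun A g \<Longrightarrow> X p (\<lambda>x. f x + g x) = X p f + X p g"
    and "\<And>p c f. smooth_fun A f \<Longrightarrow> X p (\<lambda>x. c * f x) = c * X p f"
    and "\<And>p f g. smooth_fun A f \<Longrightarrow> smooth_fun A g \<Longrightarrow>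
      X p (\<lambda>x. f x * g x) = f p * X p g + g p * X p f"
    and "\<And>p f. \<not> smooth_fun A f \<Longrightarrow> X p f = 0"
    and "\<And>f. smooth_fun A f \<Longrightarrow> smooth_fun A (\<lambda>p. X p f)"
  shows "X \<in> vfields A"
  using assms unfolding vfields_def tangent_space_def app_def by blast

lemma vfields_add:
  assumes "smooth_atlas A" "X \<in> vfields A" "Y \<in> vfields A"
  shows "X + Y \<in> vfields A"
  by (rule vfieldsI)
     (simp_all add: tangent_laws[OF vfield_tangent[OF assms(2)]]
        tangent_laws[OF vfield_tangent[OF assms(3)]]
        smooth_fun_add[OF assms(1)] vfield_smooth[OF assms(2)] vfield_smooth[OF assms(3)] algebra_simps)

lemma vfields_fun_scale:
  assumes "smooth_atlas A" "smooth_fun A h" "X \<in> vfields A"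
  shows "h \<odot> X \<in> vfields A"
  by (rule vfieldsI)
     (simp_all add: fun_scale_def tangent_laws[OF vfield_tangent[OF assms(3)]]
        smooth_fun_mult[OF assms(1,2)] vfield_smooth[OF assms(3)] algebra_simps)

lemma vfields_zero: "0 \<in> vfields A"
  by (rule vfieldsI) (simp_all add: smooth_fun_const)

lemma fun_scale_one: "(\<lambda>p. 1) \<odot> X = X"
  by (simp add: fun_scale_def)

lemma fun_scale_zero: "0 \<odot> X = 0"
  by (simp add: fun_scale_def fun_eq_iff)

lemma fun_scale_minus_one: "(\<lambda>p. - 1) \<odot> X = - X"
  by (simp add: fun_scale_def fun_eq_iff)

lemma vfields_uminus: "smooth_atlas A \<Longrightarrow> X \<in> vfields A \<Longrightarrow> - X \<in> vfields A"
  using vfields_fun_scale[OF _ smooth_fun_const[of A "- 1"]] by (simp add: fun_scale_minus_one)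

lemma vfields_diff:
  "smooth_atlas A \<Longrightarrow> X \<in> vfields A \<Longrightarrow> Y \<in> vfields A \<Longrightarrow> X - Y \<in> vfields A"
  using vfields_add[of A X "- Y"] vfields_uminus[of A Y] by simp

text \<open>
  In the product rule for the bracket the mixed terms \<open>X f \<cdot> Y g\<close> cancel. Derivations are
  additive on smooth functions only, so expanding \<open>X (f \<cdot> Y g + g \<cdot> Y f)\<close> needs both products to be smooth.
\<close>

lemma lie_bracket_vfields:
  assumes "smooth_atlas A" "X \<in> vfields A" "Y \<in> vfields A"
  shows "lie_bracket A X Y \<in> vfields A"
proof -
  note laws = tangent_laws[OF vfield_tangent[OF assms(2)]] tangent_laws[OF vfield_tangent[OF assms(3)]]
  note smooth = vfield_smooth[OF assms(2)] vfield_smooth[OF assms(3)]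
    smooth_fun_add[OF assms(1)] smooth_fun_mult[OF assms(1)] smooth_fun_diff[OF assms(1)]
    smooth_fun_const
  show ?thesis
    by (rule vfieldsI)
       (simp_all add: lie_bracket_def app_def laws smooth algebra_simps)
qed

lemma lie_bracket_antisym: "lie_bracket A Y X = - lie_bracket A X Y"
  by (simp add: lie_bracket_def fun_eq_iff)

lemma lie_bracket_add_left:
  assumes "X \<in> vfields A" "X' \<in> vfields A" "Y \<in> vfields A"
  shows "lie_bracket A (X + X') Y = lie_bracket A X Y + lie_bracket A X' Y"
  by (simp add: lie_bracket_def app_def fun_eq_iff tangent_add[OF vfield_tangent[OF assms(3)]]
      vfield_smooth[OF assms(1)] vfield_smooth[OF assms(2)])


section \<open>One-forms and their exterior derivative\<close>

lemma covariant_tensor_one: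
  assumes "covariant_tensor A 1 \<alpha>" "V \<in> vfields A"
  shows "smooth_fun A (\<alpha> [V])"
    and "W \<in> vfields A \<Longrightarrow> smooth_fun A f \<Longrightarrow> \<alpha> [f \<odot> V + W] = (\<lambda>p. f p * \<alpha> [V] p + \<alpha> [W] p)"
proof -
  have lst: "[V] \<in> vfield_lists A 1"
    using assms(2) by (simp add: vfield_lists_def)
  show "smooth_fun A (\<alpha> [V])"
    using assms(1) lst unfolding covariant_tensor_def by blast
  show "\<alpha> [f \<odot> V + W] = (\<lambda>p. f p * \<alpha> [V] p + \<alpha> [W] p)" if "W \<in> vfields A" "smooth_fun A f"
  proof -
    have "\<alpha> ([V][0 := f \<odot> V + W]) = (\<lambda>p. f p * \<alpha> ([V][0 := V]) p + \<alpha> ([V][0 := W]) p)"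
      using assms lst that unfolding covariant_tensor_def by blast
    then show ?thesis by simp
  qed
qed

lemma one_form_add:
  assumes "covariant_tensor A 1 \<alpha>" "V \<in> vfields A" "W \<in> vfields A"
  shows "\<alpha> [V + W] = \<alpha> [V] + \<alpha> [W]"
  using covariant_tensor_one(2)[OF assms smooth_fun_const[of A 1]]
  by (simp add: fun_scale_one plus_fun_def)

lemma one_form_zero:
  assumes "covariant_tensor A 1 \<alpha>"
  shows "\<alpha> [0] = 0"
  using one_form_add[OF assms vfields_zero vfields_zero] by simp

lemma one_form_fun_scale:
  assumes "covariant_tensor A 1 \<alpha>" "V \<in> vfields A" "smooth_fun A f"
  shows "\<alpha> [f \<odot> V] = f * \<alpha> [V]"
  using covariant_tensor_one(2)[OF assms(1,2) vfields_zero assms(3)]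
  by (simp add: one_form_zero[OF assms(1)] times_fun_def)

lemma one_form_uminus:
  assumes "covariant_tensor A 1 \<alpha>" "V \<in> vfields A"
  shows "\<alpha> [- V] = - \<alpha> [V]"
  using one_form_fun_scale[OF assms smooth_fun_const[of A "- 1"]]
  by (simp add: fun_scale_minus_one fun_eq_iff)

lemma ext_deriv_add_left:
  assumes "smooth_atlas A" "covariant_tensor A 1 \<alpha>"
    and "X \<in> vfields A" "X' \<in> vfields A" "Y \<in> vfields A"
  shows "ext_deriv A \<alpha> [X + X', Y] = ext_deriv A \<alpha> [X, Y] + ext_deriv A \<alpha> [X', Y]"
proof -
  have "app Y (\<alpha> [X] + \<alpha> [X']) = app Y (\<alpha> [X]) + app Y (\<alpha> [X'])"
    using tangent_add[OF vfield_tangent[OF assms(5)]] covariant_tensor_one(1)[OF assms(2)] assms(3,4)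
    by (simp add: app_def fun_eq_iff plus_fun_def)
  moreover have "app (X + X') (\<alpha> [Y]) = app X (\<alpha> [Y]) + app X' (\<alpha> [Y])"
    by (simp add: app_def fun_eq_iff)
  moreover have "\<alpha> [lie_bracket A (X + X') Y] = \<alpha> [lie_bracket A X Y] + \<alpha> [lie_bracket A X' Y]"
    using one_form_add[OF assms(2) lie_bracket_vfields lie_bracket_vfields] assms
    by (simp add: lie_bracket_add_left)
  ultimately show ?thesis
    using one_form_add[OF assms(2-4)] by (simp add: ext_deriv_def algebra_simps)
qed

lemma ext_deriv_antisym:
  assumes "smooth_atlas A" "covariant_tensor A 1 \<alpha>" "X \<in> vfields A" "Y \<in> vfields A"
  shows "ext_deriv A \<alpha> [Y, X] = - ext_deriv A \<alpha> [X, Y]"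
  using one_form_uminus[OF assms(2) lie_bracket_vfields[OF assms(1,3,4)]]
  by (simp add: ext_deriv_def lie_bracket_antisym[of A Y X])

lemma ext_deriv_zero_left:
  assumes "smooth_atlas A" "covariant_tensor A 1 \<alpha>" "Y \<in> vfields A"
  shows "ext_deriv A \<alpha> [0, Y] = 0"
  using ext_deriv_add_left[OF assms(1,2) vfields_zero vfields_zero assms(3)] by simp

lemma ext_deriv_uminus_right:
  assumes "smooth_atlas A" "covariant_tensor A 1 \<alpha>" "X \<in> vfields A" "Y \<in> vfields A"
  shows "ext_deriv A \<alpha> [X, - Y] = - ext_deriv A \<alpha> [X, Y]"
proof -
  have "ext_deriv A \<alpha> [Y, X] + ext_deriv A \<alpha> [- Y, X] = 0"
    using ext_deriv_add_left[OF assms(1,2,4) vfields_uminus[OF assms(1,4)] assms(3)]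
      ext_deriv_zero_left[OF assms(1-3)]
    by simp
  then show ?thesis
    using ext_deriv_antisym[OF assms] ext_deriv_antisym[OF assms(1-3) vfields_uminus[OF assms(1,4)]]
    by (simp add: add_eq_0_iff)
qed


section \<open>Contact triads with a Reeb field\<close>

locale reeb_triad =
  fixes A :: "('q::{t2_space,second_countable_topology}, 'e::euclidean_space) atlas"
    and n :: nat
    and lam :: "'q cotensor"
    and R :: "'q vfield"
    and J :: "'q vfield \<Rightarrow> 'q vfield"
  assumes triad: "contact_triad A n lam J"
    and reeb: "reeb_field A lam R"
begin

abbreviation "\<xi> \<equiv> contact_sections A lam"
abbreviation "\<pi> \<equiv> contact_proj lam R"
abbreviation "dlam X Y \<equiv> ext_deriv A lam [X, Y]"
abbreviation "g \<equiv> triad_metric A lam R J"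

lemma atlas: "smooth_atlas A"
  and lam_tensor: "covariant_tensor A 1 lam"
  and J_closed: "Y \<in> \<xi> \<Longrightarrow> J Y \<in> \<xi>"
  and J_square: "Y \<in> \<xi> \<Longrightarrow> J (J Y) = - Y"
  and J_invariant: "Y \<in> \<xi> \<Longrightarrow> Z \<in> \<xi> \<Longrightarrow> dlam (J Y) (J Z) = dlam Y Z"
  and J_positive: "Y \<in> \<xi> \<Longrightarrow> Y p \<noteq> 0 \<Longrightarrow> dlam Y (J Y) p > 0"
  using triad
  by (simp_all add: contact_triad_def contact_form_def differential_form_def)

lemma R_vfield: "R \<in> vfields A"
  and lam_R: "lam [R] = (\<lambda>p. 1)"
  using reeb by (simp_all add: reeb_field_def)

lemma contact_section_vfield: "Y \<in> \<xi> \<Longrightarrow> Y \<in> vfields A"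
  and contact_section_lam: "Y \<in> \<xi> \<Longrightarrow> lam [Y] = 0"
  by (simp_all add: contact_sections_def)

lemma contact_section_add: "Y \<in> \<xi> \<Longrightarrow> Z \<in> \<xi> \<Longrightarrow> Y + Z \<in> \<xi>"
  using one_form_add[OF lam_tensor] vfields_add[OF atlas] by (simp add: contact_sections_def)

lemma proj_R: "\<pi> R = 0"
  by (simp add: contact_proj_def lam_R fun_scale_one)

lemma proj_contact_section: "Y \<in> \<xi> \<Longrightarrow> \<pi> Y = Y"
  by (simp add: contact_proj_def contact_section_lam fun_scale_zero)

lemma proj_closed:
  assumes "Z \<in> vfields A"
  shows "\<pi> Z \<in> \<xi>"
proof -
  have smooth: "smooth_fun A (lam [Z])"
    using covariant_tensor_one(1)[OF lam_tensor assms] .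
  have scaled: "lam [Z] \<odot> R \<in> vfields A"
    by (rule vfields_fun_scale[OF atlas smooth R_vfield])
  have "lam [lam [Z] \<odot> R] = lam [Z]"
    using one_form_fun_scale[OF lam_tensor R_vfield smooth] by (simp add: lam_R fun_eq_iff)
  then have "lam [\<pi> Z] = 0"
    using one_form_add[OF lam_tensor assms vfields_uminus[OF atlas scaled]]
      one_form_uminus[OF lam_tensor scaled]
    by (simp add: contact_proj_def)
  then show ?thesis
    using vfields_diff[OF atlas assms scaled] by (simp add: contact_sections_def contact_proj_def)
qed

text \<open>The projection of \<open>R\<close> to \<open>\<xi>\<close> is zero, so only the first summand \<open>lam(R) lam(Z)\<close> of the metric survives.\<close>

lemma metric_R: "Z \<in> vfields A \<Longrightarrow> g [R, Z] = lam [Z]"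
  using ext_deriv_zero_left[OF atlas lam_tensor] contact_section_vfield[OF J_closed[OF proj_closed]]
  by (simp add: triad_metric_def proj_R lam_R times_fun_def)

lemma metric_contact_section:
  "Y \<in> \<xi> \<Longrightarrow> g [Y, Z] = dlam Y (J (\<pi> Z))"
  by (simp add: triad_metric_def contact_section_lam proj_contact_section)

text \<open>Differentiating \<open>lam(Z) = g(R, Z)\<close> along \<open>X\<close> leaves only the term in which \<open>R\<close> is differentiated.\<close>

lemma cov_deriv_contact_form:
  assumes "affine_connection A D" "parallel A D 2 g" "X \<in> vfields A" "Z \<in> vfields A"
  shows "cov_deriv D X lam [Z] = g [D X R, Z]"
proof -
  have "D X Z \<in> vfields A"
    using assms by (simp add: affine_connection_def)
  moreover have "cov_deriv D X g [R, Z] = 0"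
    using assms R_vfield by (simp add: parallel_def vfield_lists_def)
  ultimately show ?thesis
    using assms(4)
    by (simp add: cov_deriv_def fun_eq_iff numeral_2_eq_2 metric_R)
qed

text \<open>
  The sections \<open>U\<close> and \<open>V\<close> stand for the derivatives of \<open>R\<close> along \<open>Y\<close> and \<open>J Y\<close>. Moving \<open>J\<close> across \<open>dlam\<close>
  by invariance turns the first pairing into \<open>- dlam(J U, \<pi> Z)\<close>, and \<open>J\<^sup>2 = - 1\<close> turns the
  second into \<open>- dlam(V, \<pi> Z)\<close>.
\<close>

lemma metric_J_sum:
  assumes "U \<in> \<xi>" "V \<in> \<xi>" "Z \<in> vfields A"
  shows "g [U, Z] + g [V, J_ext lam R J Z] = - dlam (V + J U) (\<pi> Z)"
proof -
  have Z: "\<pi> Z \<in> \<xi>" by (rule proj_closed[OF assms(3)])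
  note vf = assms(1,2)[THEN contact_section_vfield] J_closed[OF assms(1), THEN contact_section_vfield]
    Z[THEN contact_section_vfield]
  have "dlam U (J (\<pi> Z)) = dlam (J U) (- \<pi> Z)"
    using J_invariant[OF assms(1) J_closed[OF Z]] by (simp add: J_square[OF Z])
  moreover have "g [V, J_ext lam R J Z] = dlam V (- \<pi> Z)"
    using assms(2) Z
    by (simp add: metric_contact_section J_ext_def proj_contact_section J_closed J_square)
  ultimately show ?thesis
    using assms(1) vf
    by (simp add: metric_contact_section ext_deriv_add_left[OF atlas lam_tensor]
        ext_deriv_uminus_right[OF atlas lam_tensor])
qed

text \<open>
  Nondegeneracy of \<open>dlam\<close> on \<open>\<xi>\<close>. The projection appears because \<open>metric_J_sum\<close> tests against
  arbitrary vector fields; testing against \<open>J W\<close>, which it fixes, suffices by positivity.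
\<close>

lemma contact_section_eq_zero_iff:
  assumes "W \<in> \<xi>"
  shows "W = 0 \<longleftrightarrow> (\<forall>Z\<in>vfields A. dlam W (\<pi> Z) = 0)"
proof
  assume "W = 0"
  then show "\<forall>Z\<in>vfields A. dlam W (\<pi> Z) = 0"
    using ext_deriv_zero_left[OF atlas lam_tensor] contact_section_vfield[OF proj_closed] by simp
next
  assume "\<forall>Z\<in>vfields A. dlam W (\<pi> Z) = 0"
  then have "dlam W (J W) = 0"
    using contact_section_vfield J_closed[OF assms] by (metis proj_contact_section)
  then have "W p = 0" for p
    using J_positive[OF assms, of p] by fastforce
  then show "W = 0" by (simp add: fun_eq_iff)
qed

end

theorem proposition1:
  fixes A :: "('q::{t2_space,second_countable_topology}, 'e::euclidean_space) atlas"
    and n :: nat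
    and lam :: "'q cotensor"
    and R :: "'q vfield"
    and J :: "'q vfield \<Rightarrow> 'q vfield"
    and D :: "'q connection"
  assumes "contact_triad A n lam J"
    and "reeb_field A lam R"
    and "affine_connection A D"
    and "parallel A D 2 (triad_metric A lam R J)"
    and "\<forall>Y\<in>vfields A. torsion A D R Y = 0"
    and "D R R = 0"
    and "\<forall>Y\<in>contact_sections A lam. D Y R \<in> contact_sections A lam"
    and "hermitian_connection A lam J (triad_metric A lam R J) (connection_pi lam R D)"
    and "\<forall>Y\<in>contact_sections A lam. contact_proj lam R (torsion A D (J Y) Y) = 0"
  shows "(\<forall>Y\<in>contact_sections A lam. D (J Y) R + J (D Y R) = 0)
           \<longleftrightarrow> CR_holomorphic A lam R J D 1 lam"
proof -
  interpret reeb_triad A n lam R J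
    using assms(1,2) by unfold_locales
  note cov_deriv_lam = cov_deriv_contact_form[OF assms(3,4)]
  have DR: "D Y R \<in> \<xi>" if "Y \<in> \<xi>" for Y
    using assms(7) that by blast
  have zero_section: "0 \<in> \<xi>"
    by (simp add: contact_sections_def vfields_zero one_form_zero[OF lam_tensor])
  have reeb_direction: "cov_deriv D R lam [Z] = 0" if "Z \<in> vfields A" for Z
    using cov_deriv_lam[OF R_vfield that] assms(6) ext_deriv_zero_left[OF atlas lam_tensor]
      contact_section_vfield[OF J_closed[OF proj_closed[OF that]]]
    by (simp add: metric_contact_section[OF zero_section])
  have contact_direction:
    "cov_deriv D Y lam [Z] + cov_deriv D (J Y) lam [J_ext lam R J Z]
       = - dlam (D (J Y) R + J (D Y R)) (\<pi> Z)"
    if "Y \<in> \<xi>" "Z \<in> vfields A" for Y Z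
  proof -
    have "J_ext lam R J Z \<in> vfields A"
      using contact_section_vfield[OF J_closed[OF proj_closed[OF that(2)]]] by (simp add: J_ext_def)
    then show ?thesis
      using that by (simp add: cov_deriv_lam contact_section_vfield J_closed metric_J_sum DR)
  qed
  have "vfield_lists A 1 = (\<lambda>Z. [Z]) ` vfields A"
    by (auto simp: vfield_lists_def length_Suc_conv)
  then have "CR_holomorphic A lam R J D 1 lam \<longleftrightarrow>
      (\<forall>Y\<in>\<xi>. \<forall>Z\<in>vfields A. dlam (D (J Y) R + J (D Y R)) (\<pi> Z) = 0)"
    by (simp add: CR_holomorphic_def reeb_direction contact_direction)
  also have "\<dots> \<longleftrightarrow> (\<forall>Y\<in>\<xi>. D (J Y) R + J (D Y R) = 0)"
    using contact_section_eq_zero_iff contact_section_add DR J_closed by simp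
  finally show ?thesis by blast
qed

end
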